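(* Let $\beta:\mathbb{N}\to(0,\infty)$ be a decreasing sequence with $\lim_{n\to\infty}\beta(n)=0$. Identify the Cantor space $\mathcal{C}=\prod_{n\in\mathbb{N}}\mathbb{Z}_2$ with the Gel'fand spectrum of $C(\mathcal{C})$ (each point being identified with the state of evaluation at that point). Then for all $x,y\in\mathcal{C}$: $$\mathsf{mk}_{L_{\mathcal{T},\lambda}^\beta}(x,y)=\begin{cases}0&\text{if }x=y,\\2\beta(\min\{n\in\mathbb{N}:x_n\neq y_n\})&\text{otherwise.}\end{cases}$$ In particular, $\mathsf{mk}_{L_{\mathcal{T},\lambda}^\beta}$ is an ultrametric on $\mathcal{C}$.
   Context: $\mathbb{N}=\{0,1,2,\ldots\}$; $\mathbb{Z}_2=\{0,1\}$ is discrete and $\mathcal{C}=\prod_{n\in\mathbb{N}}\mathbb{Z}_2$ has the product topology. $C(\mathcal{C})$ is the C*-algebra of continuous $\mathbb{C}$-valued functions on $\mathcal{C}$. Let $\eta_n\in C(\mathcal{C})$, $\eta_n((z_m)_m)=z_n$, and $u_n=2\eta_n-1_{C(\mathcal{C})}$. Let $A_0=\mathbb{C}1_{C(\mathcal{C})}$ and, for $n\geq1$, let $A_n$ be the C*-subalgebra of $C(\mathcal{C})$ generated by $1_{C(\mathcal{C})},u_0,\ldots,u_{n-1}$. With inclusion maps, $\mathcal{T}=(A_n)_{n\in\mathbb{N}}$ is an inductive sequence of finite dimensional algebras with limit $C(\mathcal{C})$. $\lambda$ is the faithful tracial state on $C(\mathcal{C})$ given by integration against the Haar probability measure of the compact group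 $\mathcal{C}$ (pointwise addition modulo $2$). Let $E_n$ be the unique conditional expectation of $C(\mathcal{C})$ onto $A_n$ with $\lambda\circ E_n=\lambda$, and for self-adjoint $f\in C(\mathcal{C})$ set $$L_{\mathcal{T},\lambda}^\beta(f)=\sup_{n\in\mathbb{N}}\frac{\|f-E_n(f)\|_{C(\mathcal{C})}}{\beta(n)}.$$ For states $\varphi,\psi$ of $C(\mathcal{C})$, the Monge-Kantorovich metric is $\mathsf{mk}_L(\varphi,\psi)=\sup\{|\varphi(f)-\psi(f)|:f=f^*\in C(\mathcal{C}),\ L(f)\leq1\}$. *)

theory Defs
  imports "HOL-Analysis.Analysis" "HOL-Library.Z2"
begin

section \<open>The Cantor space\<close>

instantiation bit :: discrete_topology
begin

definition open_bit :: "bit set \<Rightarrow> bool"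
  where "open_bit S = True"

instance
  by standard (simp_all add: open_bit_def)

end

text \<open>The function type carries the product topology.\<close>

type_synonym cantor = "nat \<Rightarrow> bit"

section \<open>The C*-algebra of continuous functions\<close>

text \<open>
  The type of bounded continuous functions already carries the vector space structure over the
  reals and the supremum norm; only the remaining C*-algebra operations are added here. Since
  \<^typ>\<open>cantor\<close> is compact, \<open>cantor \<Rightarrow>\<^sub>C complex\<close> consists of all continuous functions.
\<close>

lemma bcontfun_mult:
  fixes f g :: "'a::topological_space \<Rightarrow> complex"
  assumes "f \<in> bcontfun" and "g \<in> bcontfun"
  shows "(\<lambda>x. f x * g x) \<in> bcontfun"
proof -
  obtain a where a: "\<And>x. norm (f x) \<le> a"
    using assms(1) by (auto simp: bcontfun_def bounded_iff)
  obtain b where b: "\<And>x. norm (g x) \<le> b"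
    using assms(2) by (auto simp: bcontfun_def bounded_iff)
  have "norm (f x * g x) \<le> a * b" for x
    unfolding norm_mult using a b order_trans[OF norm_ge_zero a] by (intro mult_mono) auto
  moreover have "continuous_on UNIV (\<lambda>x. f x * g x)"
    using assms by (auto simp: bcontfun_def intro!: continuous_intros)
  ultimately show ?thesis
    by (rule bcontfun_normI[rotated])
qed

unbundle bcontfun.lifting

lift_definition scaleC_bcf ::
  "complex \<Rightarrow> ('a::topological_space \<Rightarrow>\<^sub>C complex) \<Rightarrow> ('a \<Rightarrow>\<^sub>C complex)"
  is "\<lambda>c f x. c * f x"
  by (intro bcontfun_mult const_bcontfun)

lift_definition mult_bcf ::
  "('a::topological_space \<Rightarrow>\<^sub>C complex) \<Rightarrow> ('a \<Rightarrow>\<^sub>C complex) \<Rightarrow> ('a \<Rightarrow>\<^sub>C complex)"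
  is "\<lambda>f g x. f x * g x"
  by (rule bcontfun_mult)

lift_definition star_bcf :: "('a::topological_space \<Rightarrow>\<^sub>C complex) \<Rightarrow> ('a \<Rightarrow>\<^sub>C complex)"
  is "\<lambda>f x. cnj (f x)"
  by (auto simp: bcontfun_def bounded_iff intro!: continuous_intros)

abbreviation unit_bcf :: "'a::topological_space \<Rightarrow>\<^sub>C complex"
  where "unit_bcf \<equiv> const_bcontfun 1"

definition self_adjoint :: "('a::topological_space \<Rightarrow>\<^sub>C complex) \<Rightarrow> bool"
  where "self_adjoint f \<longleftrightarrow> star_bcf f = f"

definition positive_bcf :: "('a::topological_space \<Rightarrow>\<^sub>C complex) \<Rightarrow> bool"
  where "positive_bcf f \<longleftrightarrow> (\<exists>g. f = mult_bcf (star_bcf g) g)"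

definition cstar_subalgebra :: "('a::topological_space \<Rightarrow>\<^sub>C complex) set \<Rightarrow> bool"
  where "cstar_subalgebra B \<longleftrightarrow>
    closed B \<and> 0 \<in> B \<and>
    (\<forall>f\<in>B. \<forall>g\<in>B. f + g \<in> B \<and> mult_bcf f g \<in> B) \<and>
    (\<forall>c. \<forall>f\<in>B. scaleC_bcf c f \<in> B) \<and>
    (\<forall>f\<in>B. star_bcf f \<in> B)"

definition cstar_generated ::
  "('a::topological_space \<Rightarrow>\<^sub>C complex) set \<Rightarrow> ('a \<Rightarrow>\<^sub>C complex) set"
  where "cstar_generated G = \<Inter>{B. cstar_subalgebra B \<and> G \<subseteq> B}"

definition cond_expectation ::
  "('a::topological_space \<Rightarrow>\<^sub>C complex) set \<Rightarrow>
   (('a \<Rightarrow>\<^sub>C complex) \<Rightarrow> ('a \<Rightarrow>\<^sub>C complex)) \<Rightarrow> bool"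
  where "cond_expectation B E \<longleftrightarrow>
    (\<forall>f g. E (f + g) = E f + E g) \<and>
    (\<forall>c f. E (scaleC_bcf c f) = scaleC_bcf c (E f)) \<and>
    (\<forall>f. positive_bcf f \<longrightarrow> positive_bcf (E f)) \<and>
    (\<forall>f. norm (E f) \<le> norm f) \<and>
    range E \<subseteq> B \<and> (\<forall>b\<in>B. E b = b) \<and>
    (\<forall>b\<in>B. \<forall>c\<in>B. \<forall>f. E (mult_bcf (mult_bcf b f) c) = mult_bcf (mult_bcf b (E f)) c)"

definition the_cond_expectation ::
  "(('a::topological_space \<Rightarrow>\<^sub>C complex) \<Rightarrow> complex) \<Rightarrow> ('a \<Rightarrow>\<^sub>C complex) set \<Rightarrow>
   ('a \<Rightarrow>\<^sub>C complex) \<Rightarrow> ('a \<Rightarrow>\<^sub>C complex)"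
  where "the_cond_expectation \<tau> B = (THE E. cond_expectation B E \<and> (\<forall>f. \<tau> (E f) = \<tau> f))"

section \<open>Lip-norms of inductive sequences and the Monge-Kantorovich metric\<close>

text \<open>Only the values on self-adjoint elements are used; the value may be \<open>\<infinity>\<close>.\<close>

definition lip_seminorm ::
  "(nat \<Rightarrow> ('a::topological_space \<Rightarrow>\<^sub>C complex) set) \<Rightarrow> (('a \<Rightarrow>\<^sub>C complex) \<Rightarrow> complex) \<Rightarrow>
   (nat \<Rightarrow> real) \<Rightarrow> ('a \<Rightarrow>\<^sub>C complex) \<Rightarrow> ennreal"
  where "lip_seminorm A \<tau> \<beta> f =
    (SUP n. ennreal (norm (f - the_cond_expectation \<tau> (A n) f) / \<beta> n))"

definition mk ::
  "(('a::topological_space \<Rightarrow>\<^sub>C complex) \<Rightarrow> ennreal) \<Rightarrow>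
   (('a \<Rightarrow>\<^sub>C complex) \<Rightarrow> complex) \<Rightarrow> (('a \<Rightarrow>\<^sub>C complex) \<Rightarrow> complex) \<Rightarrow> ennreal"
  where "mk L \<phi> \<psi> = (SUP f \<in> {f. self_adjoint f \<and> L f \<le> 1}. ennreal (cmod (\<phi> f - \<psi> f)))"

definition point_eval :: "'a::topological_space \<Rightarrow> ('a \<Rightarrow>\<^sub>C complex) \<Rightarrow> complex"
  where "point_eval x f = apply_bcontfun f x"

section \<open>The inductive sequence and the trace on the Cantor space\<close>

lift_definition eta :: "nat \<Rightarrow> (cantor \<Rightarrow>\<^sub>C complex)"
  is "\<lambda>n z. of_bool (z n = 1)"
proof -
  fix n :: nat
  have "continuous_on UNIV (\<lambda>z::cantor. z n)"
    by (rule continuous_on_product_coordinates)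
  moreover have "continuous_on UNIV (\<lambda>b::bit. of_bool (b = 1) :: complex)"
    by (simp add: continuous_on_open_vimage open_discrete)
  ultimately have "continuous_on UNIV (\<lambda>z::cantor. of_bool (z n = 1) :: complex)"
    using continuous_on_compose2 by blast
  then show "(\<lambda>z::cantor. of_bool (z n = 1)) \<in> (bcontfun :: (cantor \<Rightarrow> complex) set)"
    by (rule bcontfun_normI[where b = 1]) simp
qed

definition u :: "nat \<Rightarrow> (cantor \<Rightarrow>\<^sub>C complex)"
  where "u n = 2 *\<^sub>R eta n - unit_bcf"

definition cantor_alg :: "nat \<Rightarrow> (cantor \<Rightarrow>\<^sub>C complex) set"
  where "cantor_alg n =
    (if n = 0 then range (\<lambda>c. scaleC_bcf c unit_bcf)
     else cstar_generated (insert unit_bcf (u ` {..<n})))"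

text \<open>
  Regularity is not required explicitly: every finite Borel measure on the compact metrizable
  space \<^typ>\<open>cantor\<close> is regular.
\<close>

definition haar_probability :: "cantor measure \<Rightarrow> bool"
  where "haar_probability \<mu> \<longleftrightarrow>
    sets \<mu> = sets borel \<and> emeasure \<mu> (space \<mu>) = 1 \<and>
    (\<forall>a. distr \<mu> borel (\<lambda>z m. a m + z m) = \<mu>)"

definition haar :: "cantor measure"
  where "haar = (THE \<mu>. haar_probability \<mu>)"

definition haar_trace :: "(cantor \<Rightarrow>\<^sub>C complex) \<Rightarrow> complex"
  where "haar_trace f = (LINT z|haar. apply_bcontfun f z)"

section \<open>Ultrametrics\<close>

definition ultrametric :: "'a set \<Rightarrow> ('a \<Rightarrow> 'a \<Rightarrow> real) \<Rightarrow> bool"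
  where "ultrametric M d \<longleftrightarrow>
    Metric_space M d \<and> (\<forall>x\<in>M. \<forall>y\<in>M. \<forall>z\<in>M. d x z \<le> max (d x y) (d y z))"

end

theory Submission
  imports Defs "HOL-Probability.Infinite_Product_Measure"
begin

text \<open>
  The algebra \<open>A\<^sub>n\<close> consists of the functions that depend on the first \<open>n\<close> coordinates only
  (\<open>cantor_alg_eq_cylinder_alg\<close>), and \<open>E\<^sub>n\<close> averages a function over the remaining coordinates
  (\<open>the_cond_expectation_cantor_alg\<close>). Given this, let \<open>n\<close> be the first index at which \<open>x\<close> and
  \<open>y\<close> differ.

  If \<open>L f \<le> 1\<close>, then \<open>E\<^sub>n f\<close> takes the same value at \<open>x\<close> and \<open>y\<close>, so
  \<open>f x - f y = (f - E\<^sub>n f) x - (f - E\<^sub>n f) y\<close> has modulus at most \<open>2 * \<beta> n\<close> (\<open>dist_eval_le\<close>).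
  The bound is attained by \<open>\<beta> n * u n\<close>: this function takes the values \<open>\<beta> n\<close> and \<open>- \<beta> n\<close>
  at the two points, it is fixed by \<open>E\<^sub>k\<close> for \<open>k > n\<close> and killed by \<open>E\<^sub>k\<close> for \<open>k \<le> n\<close>, and
  \<open>\<beta> n \<le> \<beta> k\<close> in the latter case, so its seminorm is at most \<open>1\<close>
  (\<open>lip_seminorm_scaled_u\<close>). Ultrametricity is the fact that if \<open>x\<close> and \<open>z\<close> differ at \<open>m\<close>, then
  every \<open>y\<close> differs from \<open>x\<close> or from \<open>z\<close> at \<open>m\<close> (\<open>ultrametric_first_difference\<close>).

  The Haar measure and the \<open>E\<^sub>n\<close> are given by definite description, so most of the work is
  existence and uniqueness of both. The common tool is \<open>haar_integral_average\<close>: averaging the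
  translation invariance over the finite group of sequences that vanish from \<open>n\<close> on shows that
  every invariant probability measure integrates a function by first averaging over its first
  \<open>n\<close> coordinates. This determines the measure of all cylinder sets, hence the Haar measure; it
  shows that \<open>E\<^sub>n\<close> preserves the trace without recourse to Fubini's theorem; and it turns the
  trace on \<open>A\<^sub>n\<close> into a finite average, which is faithful and so makes \<open>E\<^sub>n\<close> unique.
\<close>

section \<open>The topology of the Cantor space\<close>

lemma finite_UNIV_bit: "finite (UNIV :: bit set)"
  by (rule finite_subset[of _ "{0, 1}"]) (auto intro: bit.exhaust)

text \<open>
  Second countability makes the Borel sets of the Cantor space agree with the product sigma-algebra.
\<close>

instance bit :: second_countable_topology
proof
  have "countable (UNIV :: bit set set)"
    using finite_UNIV_bit by (simp add: Finite_Set.finite_set countable_finite)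
  moreover have "open = generate_topology (UNIV :: bit set set)"
    by (auto simp: fun_eq_iff open_discrete intro: generate_topology.Basis)
  ultimately show "\<exists>B :: bit set set. countable B \<and> open = generate_topology B"
    by blast
qed

lemma continuous_on_coordinatewise:
  "continuous_on UNIV (\<lambda>(z :: cantor) m. g m (z m) :: bit)"
proof (rule continuous_on_coordinatewise_then_product)
  fix m
  have "continuous_on UNIV (g m)"
    by (simp add: continuous_on_open_vimage open_discrete)
  then show "continuous_on UNIV (\<lambda>z :: cantor. g m (z m))"
    by (rule continuous_on_compose2[OF _ continuous_on_product_coordinates]) simp
qed

lemma borel_measurable_translation: "(\<lambda>(z :: cantor) m. a m + z m) \<in> borel_measurable borel"
  by (rule borel_measurable_continuous_onI[OF continuous_on_coordinatewise])

text \<open>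
  The point \<open>override_on z x {..<n}\<close> has the first \<open>n\<close> coordinates of \<open>x\<close> and the tail of \<open>z\<close>;
  for fixed \<open>x\<close> these points run through the cylinder of level \<open>n\<close> around \<open>x\<close>.
\<close>

lemma continuous_on_override: "continuous_on UNIV (\<lambda>z :: cantor. override_on z x A)"
  unfolding override_on_def
  using continuous_on_coordinatewise[of "\<lambda>m b. if m \<in> A then x m else b"] by simp

definition cylindrical :: "nat \<Rightarrow> (cantor \<Rightarrow> 'b) \<Rightarrow> bool"
  where "cylindrical n f \<longleftrightarrow> (\<forall>x y. (\<forall>i<n. x i = y i) \<longrightarrow> f x = f y)"

lemma cylindricalD: "cylindrical n f \<Longrightarrow> (\<And>i. i < n \<Longrightarrow> x i = y i) \<Longrightarrow> f x = f y"
  unfolding cylindrical_def by blast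

lemma cylindrical_override: "cylindrical n f \<Longrightarrow> f (override_on z x {..<n}) = f x"
  by (rule cylindricalD) (auto simp: override_on_def)

definition prefix_group :: "nat \<Rightarrow> cantor set"
  where "prefix_group n = {a. \<forall>i\<ge>n. a i = 0}"

lemma finite_prefix_group: "finite (prefix_group n)"
proof -
  have "finite {a :: cantor. \<forall>i. (i \<in> {..<n} \<longrightarrow> a i \<in> UNIV) \<and> (i \<notin> {..<n} \<longrightarrow> a i = 0)}"
    by (intro finite_set_of_finite_funs finite_UNIV_bit finite_lessThan)
  then show ?thesis
    by (simp add: prefix_group_def not_less)
qed

lemma card_prefix_group_pos: "0 < card (prefix_group n)"
proof -
  have "(\<lambda>_. 0) \<in> prefix_group n"
    by (simp add: prefix_group_def)
  then show ?thesis
    using finite_prefix_group card_gt_0_iff by blast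
qed

lemma ex_prefix:
  obtains a where "a \<in> prefix_group n" "\<And>i. i < n \<Longrightarrow> a i = x i"
proof
  show "override_on (\<lambda>_. 0) x {..<n} \<in> prefix_group n"
    by (simp add: prefix_group_def)
qed simp

text \<open>
  Cylinders are open, so a cylindrical function is locally constant; all its values are attained on the
  finite prefix group.
\<close>

lemma cylindrical_bcontfun:
  fixes h :: "cantor \<Rightarrow> 'b::metric_space"
  assumes "cylindrical n h"
  shows "h \<in> bcontfun"
proof -
  have "range h \<subseteq> h ` prefix_group n"
  proof safe
    fix x
    obtain a where "a \<in> prefix_group n" "\<And>i. i < n \<Longrightarrow> a i = x i"
      by (rule ex_prefix[of n x]) blast
    then show "h x \<in> h ` prefix_group n"
      using cylindricalD[OF assms] by (metis imageI)
  qed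
  then have "bounded (range h)"
    by (meson finite_imp_bounded finite_imageI finite_prefix_group finite_subset)
  moreover have "continuous_on UNIV h"
    unfolding continuous_on_def
  proof
    fix x
    have "{z. \<forall>i<n. z i = x i} = (\<Inter>i<n. (\<lambda>z :: cantor. z i) -` {x i})"
      by auto
    moreover have "open \<dots>"
      by (intro open_INT ballI open_vimage open_discrete continuous_on_product_coordinates) simp
    ultimately have "open {z. \<forall>i<n. z i = x i}"
      by simp
    then have "\<forall>\<^sub>F z in at x. h x = h z"
      unfolding eventually_at_topological
      by (intro exI[of _ "{z. \<forall>i<n. z i = x i}"]) (auto intro!: cylindricalD[OF assms])
    then show "(h \<longlongrightarrow> h x) (at x)"
      by (rule tendsto_eventually[OF eventually_mono]) simp
  qed
  ultimately show ?thesis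
    by (simp add: bcontfun_def)
qed

section \<open>The Haar measure\<close>

lemma haar_probability_prob_space: "haar_probability \<mu> \<Longrightarrow> prob_space \<mu>"
  by (simp add: haar_probability_def prob_spaceI)

text \<open>
  Integrate the identity \<open>LINT z. f z = LINT z. f (a + z)\<close> over all \<open>a\<close> in the prefix group. For
  fixed \<open>z\<close>, the points \<open>a + z\<close> all have the tail of \<open>z\<close>, and their prefixes run through all
  prefixes exactly once.
\<close>

lemma haar_integral_average:
  fixes f :: "cantor \<Rightarrow> 'b::{banach, second_countable_topology}"
  assumes \<mu>: "haar_probability \<mu>" and f: "f \<in> borel_measurable borel"
    and B: "\<And>x. norm (f x) \<le> B"
  shows "(LINT z|\<mu>. f z) =
    (\<Sum>a\<in>prefix_group n. LINT z|\<mu>. f (override_on z a {..<n})) /\<^sub>R card (prefix_group n)"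
proof -
  interpret prob_space \<mu>
    using \<mu> by (rule haar_probability_prob_space)
  let ?G = "prefix_group n"
  have sets: "sets \<mu> = sets borel"
    using \<mu> by (simp add: haar_probability_def)
  have transl: "(\<lambda>z m. a m + z m) \<in> measurable \<mu> borel" for a :: cantor
    using borel_measurable_translation
    by (simp add: measurable_cong_sets[OF sets refl])
  have over: "(\<lambda>z. override_on z a {..<n}) \<in> measurable \<mu> borel" for a :: cantor
    using borel_measurable_continuous_onI[OF continuous_on_override]
    by (simp add: measurable_cong_sets[OF sets refl])
  have int: "integrable \<mu> (\<lambda>z. f (g z))" if "g \<in> measurable \<mu> borel" for g
    using B measurable_compose[OF that f] by (intro integrable_const_bound[where B = B]) auto
  have inv: "(LINT z|\<mu>. f z) = (LINT z|\<mu>. f (\<lambda>m. a m + z m))" for a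
  proof -
    have "distr \<mu> borel (\<lambda>z m. a m + z m) = \<mu>"
      using \<mu> by (simp add: haar_probability_def)
    then show ?thesis
      using integral_distr[OF transl f, of a] by simp
  qed
  have shift: "(\<Sum>a\<in>?G. f (\<lambda>m. a m + z m)) = (\<Sum>a\<in>?G. f (override_on z a {..<n}))" for z
  proof -
    \<comment> \<open>Translation of prefixes by the prefix of \<open>z\<close>; it is its own inverse since \<open>b + b = 0\<close>.\<close>
    define h where "h a = (\<lambda>i. if i < n then a i + z i else 0)" for a :: cantor
    have bit_cancel: "b + c + c = b" for b c :: bit
      by (cases c) simp_all
    have "h (h a) = a" if "a \<in> ?G" for a
      using that by (auto simp: h_def prefix_group_def fun_eq_iff bit_cancel)
    moreover have "h a \<in> ?G" for a
      by (simp add: h_def prefix_group_def)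
    moreover have "override_on z (h a) {..<n} = (\<lambda>m. a m + z m)" if "a \<in> ?G" for a
      using that by (auto simp: h_def prefix_group_def override_on_def fun_eq_iff)
    ultimately show ?thesis
      by (intro sum.reindex_bij_witness[of _ h h]) auto
  qed
  have "card ?G *\<^sub>R (LINT z|\<mu>. f z) = (\<Sum>a\<in>?G. LINT z|\<mu>. f z)"
    by (simp add: sum_constant_scaleR)
  also have "\<dots> = (\<Sum>a\<in>?G. LINT z|\<mu>. f (\<lambda>m. a m + z m))"
    using inv by (rule sum.cong[OF refl])
  also have "\<dots> = (LINT z|\<mu>. (\<Sum>a\<in>?G. f (\<lambda>m. a m + z m)))"
    by (rule Bochner_Integration.integral_sum[symmetric]) (rule int[OF transl])
  also have "\<dots> = (LINT z|\<mu>. (\<Sum>a\<in>?G. f (override_on z a {..<n})))"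
    by (simp only: shift)
  also have "\<dots> = (\<Sum>a\<in>?G. LINT z|\<mu>. f (override_on z a {..<n}))"
    by (rule Bochner_Integration.integral_sum) (rule int[OF over])
  finally have "card ?G *\<^sub>R (LINT z|\<mu>. f z) = (\<Sum>a\<in>?G. LINT z|\<mu>. f (override_on z a {..<n}))" .
  then show ?thesis
    using card_prefix_group_pos[of n] by (simp add: divideR_right flip: divide_inverse)
qed

lemma haar_integral_cylindrical:
  fixes f :: "cantor \<Rightarrow> 'b::{banach, second_countable_topology}"
  assumes \<mu>: "haar_probability \<mu>" and f: "cylindrical n f"
  shows "(LINT z|\<mu>. f z) = (\<Sum>a\<in>prefix_group n. f a) /\<^sub>R card (prefix_group n)"
proof -
  interpret prob_space \<mu>
    using \<mu> by (rule haar_probability_prob_space)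
  have "f \<in> bcontfun"
    using f by (rule cylindrical_bcontfun)
  then have "f \<in> borel_measurable borel" and "bounded (range f)"
    by (auto simp: bcontfun_def intro: borel_measurable_continuous_onI)
  then obtain B where "\<And>x. norm (f x) \<le> B"
    by (auto simp: bounded_iff)
  from haar_integral_average[OF \<mu> \<open>f \<in> borel_measurable borel\<close> this, of n] show ?thesis
    by (simp add: cylindrical_override[OF f] prob_space)
qed

lemma sets_borel_bit: "sets (borel :: bit measure) = UNIV"
  by (auto intro!: borel_open open_discrete)

lemma sets_PiM_bit:
  assumes "\<And>i. sets (M i) = (UNIV :: bit set set)"
  shows "sets (PiM UNIV M) = sets (borel :: cantor measure)"
  unfolding sets_PiM_equal_borel[symmetric]
  using assms by (intro sets_PiM_cong) (auto simp: sets_borel_bit)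

text \<open>
  Membership in a box with finitely many constrained coordinates is a cylindrical condition, so
  its measure is the proportion of elements of the prefix group that satisfy it. Boxes form a
  generator of the sigma-algebra that is stable under intersection.
\<close>

lemma haar_probability_unique:
  assumes "haar_probability \<mu>" "haar_probability \<nu>"
  shows "\<mu> = \<nu>"
proof (rule measure_eqI_PiM_infinite)
  interpret \<mu>: prob_space \<mu>
    using assms(1) by (rule haar_probability_prob_space)
  interpret \<nu>: prob_space \<nu>
    using assms(2) by (rule haar_probability_prob_space)
  let ?M = "\<lambda>_ :: nat. borel :: bit measure"
  show sets: "sets \<mu> = PiM UNIV ?M" "sets \<nu> = PiM UNIV ?M"
    using assms by (simp_all add: haar_probability_def sets_PiM_equal_borel)
  show "finite_measure \<mu>"
    by (rule \<mu>.finite_measure_axioms)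
  fix A :: "nat \<Rightarrow> bit set" and J :: "nat set"
  assume J: "finite J" and A: "\<And>i. i \<in> J \<Longrightarrow> A i \<in> sets borel"
  define X where "X = prod_emb UNIV ?M J (Pi\<^sub>E J A)"
  have X: "X = {z. \<forall>i\<in>J. z i \<in> A i}"
    by (auto simp: X_def prod_emb_def PiE_iff)
  obtain n where n: "J \<subseteq> {..<n}"
    using J finite_nat_bounded by blast
  have cyl: "cylindrical n (indicator X :: cantor \<Rightarrow> real)"
    using n by (force simp: cylindrical_def X indicator_def subset_iff)
  have "X \<in> sets (PiM UNIV ?M)"
    unfolding X_def using J A by (intro sets_PiM_I) auto
  then have "X \<in> sets \<mu>" "X \<in> sets \<nu>"
    by (simp_all add: sets)
  then have "measure \<mu> X = (LINT z|\<mu>. indicator X z)" "measure \<nu> X = (LINT z|\<nu>. indicator X z)"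
    by simp_all
  then have "measure \<mu> X = measure \<nu> X"
    using haar_integral_cylindrical[OF assms(1) cyl] haar_integral_cylindrical[OF assms(2) cyl]
    by simp
  then show "\<mu> X = \<nu> X"
    by (simp add: \<mu>.emeasure_eq_measure \<nu>.emeasure_eq_measure)
qed

text \<open>
  The infinite product of the fair coin measures is invariant because a translation acts on each
  coordinate by a permutation, and permutations preserve the counting measure.
\<close>

lemma haar_probability_exists: "\<exists>\<mu>. haar_probability \<mu>"
proof -
  define M where "M = (\<lambda>_ :: nat. uniform_count_measure (UNIV :: bit set))"
  have prob: "prob_space (M i)" for i
    unfolding M_def by (rule prob_space_uniform_count_measure) (simp_all add: finite_UNIV_bit)
  interpret product_prob_space M UNIV
    using prob by (rule product_prob_spaceI)
  have sets_M: "sets (M i) = UNIV" for i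
    by (simp add: M_def)
  have sets: "sets (PiM UNIV M) = sets borel"
    using sets_M by (rule sets_PiM_bit)
  have "distr (PiM UNIV M) borel (\<lambda>z m. a m + z m) = PiM UNIV M" for a :: cantor
  proof -
    let ?t = "\<lambda>(z :: cantor) m. a m + z m"
    have t: "?t \<in> measurable (PiM UNIV M) borel"
      using borel_measurable_translation
      by (simp add: measurable_cong_sets[OF sets refl])
    show ?thesis
    proof (rule measure_eqI_PiM_infinite)
      show "sets (distr (PiM UNIV M) borel ?t) = PiM UNIV M"
        by (simp add: sets)
      show "finite_measure (distr (PiM UNIV M) borel ?t)"
        using P.prob_space_distr[OF t] by (simp add: prob_space_def)
      fix A :: "nat \<Rightarrow> bit set" and J :: "nat set"
      assume J: "finite J"
      define X where "X B = prod_emb UNIV M J (Pi\<^sub>E J B)" for B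
      have X: "X B = {z. \<forall>i\<in>J. z i \<in> B i}" for B
        by (auto simp: X_def prod_emb_def PiE_iff M_def space_uniform_count_measure)
      have "X A \<in> sets borel"
        unfolding X_def sets[symmetric] using J by (intro sets_PiM_I) (auto simp: sets_M)
      then have "distr (PiM UNIV M) borel ?t (X A) = PiM UNIV M (?t -` X A)"
        using emeasure_distr[OF t] sets_eq_imp_space_eq[OF sets] by simp
      also have "?t -` X A = X (\<lambda>i. (+) (a i) -` A i)"
        by (auto simp: X)
      also have "PiM UNIV M \<dots> = (\<Prod>i\<in>J. M i ((+) (a i) -` A i))"
        unfolding X_def using J by (intro emeasure_PiM_emb) (auto simp: sets_M)
      also have "\<dots> = (\<Prod>i\<in>J. M i (A i))"
      proof (rule prod.cong[OF refl])
        fix i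
        have surj: "range ((+) c) = UNIV" for c :: bit
        proof -
          have "b = c + (c + b)" for b
            by (cases c; cases b) simp_all
          then show ?thesis
            by blast
        qed
        have "card ((+) (a i) -` A i) = card (A i)"
          by (rule card_vimage_inj) (simp_all only: surj subset_UNIV inj_on_def add_left_cancel simp_thms ball_simps)
        then show "M i ((+) (a i) -` A i) = M i (A i)"
          by (simp add: M_def emeasure_uniform_count_measure finite_UNIV_bit)
      qed
      also have "\<dots> = PiM UNIV M (X A)"
        unfolding X_def using J by (intro emeasure_PiM_emb[symmetric]) (auto simp: sets_M)
      finally show "distr (PiM UNIV M) borel ?t (prod_emb UNIV M J (Pi\<^sub>E J A)) =
          PiM UNIV M (prod_emb UNIV M J (Pi\<^sub>E J A))"
        by (simp add: X_def)
    qed simp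
  qed
  then have "haar_probability (PiM UNIV M)"
    by (simp add: haar_probability_def sets P.emeasure_space_1)
  then show ?thesis ..
qed

lemma haar_probability_haar: "haar_probability haar"
  unfolding haar_def
  using haar_probability_exists haar_probability_unique by (metis theI)

interpretation haar: prob_space haar
  using haar_probability_haar by (rule haar_probability_prob_space)

lemma haar_integrable:
  "g \<in> borel_measurable borel \<Longrightarrow> integrable haar (\<lambda>z. apply_bcontfun f (g z))"
  for f :: "cantor \<Rightarrow>\<^sub>C complex"
proof -
  assume g: "g \<in> borel_measurable borel"
  have sets: "sets haar = sets borel"
    using haar_probability_haar by (simp add: haar_probability_def)
  have "apply_bcontfun f \<in> borel_measurable borel"
    by (intro borel_measurable_continuous_onI continuous_on_apply_bcontfun)
  then have "(\<lambda>z. f (g z)) \<in> borel_measurable haar"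
    using measurable_compose[OF g] by (simp add: measurable_cong_sets[OF sets refl])
  then show ?thesis
    by (intro haar.integrable_const_bound[where B = "norm f"]) (simp_all add: norm_bounded)
qed

section \<open>The algebras of the inductive sequence\<close>

lemmas bcf_apply = scaleC_bcf.rep_eq mult_bcf.rep_eq star_bcf.rep_eq

lemma u_apply: "apply_bcontfun (u n) z = (if z n = 1 then 1 else -1)"
  by (simp add: u_def eta.rep_eq scaleR_conv_of_real)

definition cylinder_alg :: "nat \<Rightarrow> (cantor \<Rightarrow>\<^sub>C complex) set"
  where "cylinder_alg n = {f. cylindrical n (apply_bcontfun f)}"

lemma cstar_subalgebra_cylinder_alg: "cstar_subalgebra (cylinder_alg n)"
proof -
  have "closed (cylinder_alg n)"
    unfolding closed_sequential_limits
  proof safe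
    fix f l
    assume f: "\<forall>k. f k \<in> cylinder_alg n" and lim: "f \<longlonglongrightarrow> l"
    have lim': "(\<lambda>k. f k x) \<longlonglongrightarrow> l x" for x
      using tendsto_bcontfun_uniform_limit[OF lim] by (rule tendsto_uniform_limitI) simp
    have "l x = l y" if "\<forall>i<n. x i = y i" for x y
    proof (rule LIMSEQ_unique[OF lim'])
      have "f k x = f k y" for k
        using f that by (auto simp: cylinder_alg_def cylindrical_def)
      then show "(\<lambda>k. f k x) \<longlonglongrightarrow> l y"
        using lim'[of y] by simp
    qed
    then show "l \<in> cylinder_alg n"
      by (auto simp: cylinder_alg_def cylindrical_def)
  qed
  moreover have "f + g \<in> cylinder_alg n" "mult_bcf f g \<in> cylinder_alg n"
    if "f \<in> cylinder_alg n" "g \<in> cylinder_alg n" for f g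
    using that unfolding cylinder_alg_def mem_Collect_eq cylindrical_def plus_bcontfun.rep_eq bcf_apply
    by metis+
  moreover have "scaleC_bcf c f \<in> cylinder_alg n" "star_bcf f \<in> cylinder_alg n"
    if "f \<in> cylinder_alg n" for c f
    using that unfolding cylinder_alg_def mem_Collect_eq cylindrical_def bcf_apply by metis+
  moreover have "0 \<in> cylinder_alg n"
    by (simp add: cylinder_alg_def cylindrical_def)
  ultimately show ?thesis
    by (simp add: cstar_subalgebra_def)
qed

lemma cylinder_alg_0:
  assumes "f \<in> cylinder_alg 0"
  shows "f = scaleC_bcf (f (\<lambda>_. 0)) unit_bcf"
proof (rule bcontfun_eqI)
  fix x
  have "f x = f (\<lambda>_. 0)"
    using assms unfolding cylinder_alg_def mem_Collect_eq cylindrical_def by blast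
  then show "f x = scaleC_bcf (f (\<lambda>_. 0)) unit_bcf x"
    by (simp add: bcf_apply)
qed

text \<open>
  The coordinate \<open>n\<close> takes two values, so
  \<open>f x = f (x(n := 1)) * (1 + u n x) / 2 + f (x(n := 0)) * (1 - u n x) / 2\<close>: the fractions are the
  indicators of \<open>x n = 1\<close> and \<open>x n = 0\<close>. If \<open>f\<close> depends on the first \<open>n + 1\<close> coordinates, then the
  two restrictions depend on the first \<open>n\<close> only.
\<close>

lemma cylinder_alg_subset:
  assumes B: "cstar_subalgebra B" "unit_bcf \<in> B"
  shows "u ` {..<n} \<subseteq> B \<Longrightarrow> cylinder_alg n \<subseteq> B"
proof (induction n)
  case 0
  have "f \<in> B" if "f \<in> cylinder_alg 0" for f
    using B cylinder_alg_0[OF that] unfolding cstar_subalgebra_def by metis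
  then show ?case
    by blast
next
  case (Suc n)
  have add: "f + g \<in> B" and mult: "mult_bcf f g \<in> B" if "f \<in> B" "g \<in> B" for f g
    using B that by (auto simp: cstar_subalgebra_def)
  have scale: "scaleC_bcf c f \<in> B" if "f \<in> B" for c f
    using B that by (auto simp: cstar_subalgebra_def)
  have IH: "cylinder_alg n \<subseteq> B" and u: "u n \<in> B"
    using Suc by (simp_all add: lessThan_Suc)
  show ?case
  proof
    fix f
    assume f: "f \<in> cylinder_alg (Suc n)"
    define s where "s b = Bcontfun (\<lambda>x. f (x(n := b)))" for b
    have cyl: "cylindrical n (\<lambda>x. f (x(n := b)))" for b
      using f by (auto simp: cylinder_alg_def less_Suc_eq cylindrical_def)
    have s: "apply_bcontfun (s b) = (\<lambda>x. f (x(n := b)))" for b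
      by (simp add: s_def Bcontfun_inverse cylindrical_bcontfun[OF cyl])
    then have "s b \<in> cylinder_alg n" for b
      using cyl by (simp add: cylinder_alg_def)
    then have sB: "s b \<in> B" for b
      using IH by blast
    define p where "p = scaleC_bcf (1/2) (unit_bcf + u n)"
    define q where "q = scaleC_bcf (1/2) (unit_bcf + scaleC_bcf (-1) (u n))"
    have "f x = (mult_bcf (s 1) p + mult_bcf (s 0) q) x" for x
    proof (cases "x n = 1")
      case False
      then have "x n = 0"
        by simp
      then have "x(n := 0) = x"
        by (rule fun_upd_idem)
      then show ?thesis
        using False by (simp add: bcf_apply p_def q_def s u_apply)
    next
      case True
      then have "x(n := 1) = x"
        by (rule fun_upd_idem)
      then show ?thesis
        using True by (simp add: bcf_apply p_def q_def s u_apply)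
    qed
    then have "f = mult_bcf (s 1) p + mult_bcf (s 0) q"
      by (rule bcontfun_eqI)
    moreover have "p \<in> B" "q \<in> B"
      unfolding p_def q_def by (intro scale add B u)+
    ultimately show "f \<in> B"
      using sB by (simp add: add mult)
  qed
qed

lemma cantor_alg_eq_cylinder_alg: "cantor_alg n = cylinder_alg n"
proof (cases "n = 0")
  case True
  have "f \<in> range (\<lambda>c. scaleC_bcf c unit_bcf)" if "f \<in> cylinder_alg 0" for f
    using cylinder_alg_0[OF that] by blast
  then show ?thesis
    using True by (auto simp: cantor_alg_def cylinder_alg_def cylindrical_def bcf_apply)
next
  case False
  have "insert unit_bcf (u ` {..<n}) \<subseteq> cylinder_alg n"
    by (auto simp: cylinder_alg_def cylindrical_def u_apply)
  then have "cstar_generated (insert unit_bcf (u ` {..<n})) \<subseteq> cylinder_alg n"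
    using cstar_subalgebra_cylinder_alg by (auto simp: cstar_generated_def)
  moreover have "cylinder_alg n \<subseteq> cstar_generated (insert unit_bcf (u ` {..<n}))"
    unfolding cstar_generated_def using cylinder_alg_subset by blast
  ultimately show ?thesis
    using False by (simp add: cantor_alg_def)
qed

section \<open>The conditional expectations\<close>

definition cyl_expectation :: "nat \<Rightarrow> (cantor \<Rightarrow>\<^sub>C complex) \<Rightarrow> (cantor \<Rightarrow>\<^sub>C complex)"
  where "cyl_expectation n f = Bcontfun (\<lambda>x. LINT z|haar. f (override_on z x {..<n}))"

lemma override_cong: "(\<And>i. i < n \<Longrightarrow> x i = y i) \<Longrightarrow> override_on z x {..<n} = override_on z y {..<n}"
  for x y z :: cantor
  by (auto simp: override_on_def)

lemma cylindrical_fibre_integral: "cylindrical n (\<lambda>x. LINT z|haar. f (override_on z x {..<n}))"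
  unfolding cylindrical_def by (auto cong: override_cong)

lemma cyl_expectation_apply:
  "apply_bcontfun (cyl_expectation n f) = (\<lambda>x. LINT z|haar. f (override_on z x {..<n}))"
  by (simp add: cyl_expectation_def Bcontfun_inverse
      cylindrical_bcontfun[OF cylindrical_fibre_integral])

lemma cyl_expectation_in_cylinder_alg: "cyl_expectation n f \<in> cylinder_alg n"
  by (simp add: cylinder_alg_def cyl_expectation_apply cylindrical_fibre_integral)

lemma cyl_expectation_cong:
  "(\<And>i. i < n \<Longrightarrow> x i = y i) \<Longrightarrow> cyl_expectation n f x = cyl_expectation n f y"
  using cyl_expectation_in_cylinder_alg unfolding cylinder_alg_def by (blast dest: cylindricalD)

lemma cyl_expectation_id: "f \<in> cylinder_alg n \<Longrightarrow> cyl_expectation n f = f"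
  by (intro bcontfun_eqI)
    (simp add: cyl_expectation_apply cylinder_alg_def cylindrical_override haar.prob_space)

lemma fibre_integrable:
  "integrable haar (\<lambda>z. apply_bcontfun f (override_on z x {..<n}))" for f :: "cantor \<Rightarrow>\<^sub>C complex"
  by (rule haar_integrable[OF borel_measurable_continuous_onI[OF continuous_on_override]])

text \<open>
  A positive element is the square of its pointwise square root, which is continuous because it
  depends on the same coordinates as \<open>f\<close>.
\<close>

lemma positive_bcf_of_nonneg:
  assumes "f \<in> cylinder_alg n" "\<And>x. f x \<in> \<real>" "\<And>x. 0 \<le> Re (f x)"
  shows "positive_bcf f"
proof -
  define g where "g = Bcontfun (\<lambda>x. complex_of_real (sqrt (Re (f x))))"
  have "cylindrical n (\<lambda>x. complex_of_real (sqrt (Re (f x))))"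
    using assms(1) unfolding cylinder_alg_def mem_Collect_eq cylindrical_def by metis
  then have "g x = complex_of_real (sqrt (Re (f x)))" for x
    by (simp add: g_def Bcontfun_inverse cylindrical_bcontfun)
  then have "f = mult_bcf (star_bcf g) g"
    using assms(2,3)
    by (intro bcontfun_eqI) (simp add: bcf_apply complex_is_Real_iff complex_eq_iff)
  then show ?thesis
    by (auto simp: positive_bcf_def)
qed

lemma cond_expectation_cyl_expectation: "cond_expectation (cylinder_alg n) (cyl_expectation n)"
  unfolding cond_expectation_def
proof (intro conjI allI ballI impI)
  fix f g :: "cantor \<Rightarrow>\<^sub>C complex" and c :: complex
  show "cyl_expectation n (f + g) = cyl_expectation n f + cyl_expectation n g"
    by (intro bcontfun_eqI) (simp add: cyl_expectation_apply fibre_integrable)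
  show "cyl_expectation n (scaleC_bcf c f) = scaleC_bcf c (cyl_expectation n f)"
    by (intro bcontfun_eqI) (simp add: cyl_expectation_apply bcf_apply)
  show "norm (cyl_expectation n f) \<le> norm f"
  proof (rule norm_bound)
    fix x
    have "norm (cyl_expectation n f x) \<le> (LINT z|haar. norm (f (override_on z x {..<n})))"
      unfolding cyl_expectation_apply by (rule integral_norm_bound)
    also have "\<dots> \<le> (LINT z|haar. norm f)"
      by (intro integral_mono integrable_norm fibre_integrable) (simp_all add: norm_bounded)
    finally show "norm (cyl_expectation n f x) \<le> norm f"
      by (simp add: haar.prob_space)
  qed
  show "range (cyl_expectation n) \<subseteq> cylinder_alg n"
    using cyl_expectation_in_cylinder_alg by blast
  show "cyl_expectation n b = b" if "b \<in> cylinder_alg n" for b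
    using that by (rule cyl_expectation_id)
  show "cyl_expectation n (mult_bcf (mult_bcf b f) c) = mult_bcf (mult_bcf b (cyl_expectation n f)) c"
    if "b \<in> cylinder_alg n" "c \<in> cylinder_alg n" for b c
    using that
    by (intro bcontfun_eqI)
      (simp add: cyl_expectation_apply bcf_apply cylinder_alg_def cylindrical_override)
  show "positive_bcf (cyl_expectation n f)" if pos: "positive_bcf f"
  proof (rule positive_bcf_of_nonneg[OF cyl_expectation_in_cylinder_alg])
    obtain g where "f = mult_bcf (star_bcf g) g"
      using pos by (auto simp: positive_bcf_def)
    then have f: "f x = complex_of_real ((cmod (g x))\<^sup>2)" for x
      by (simp add: bcf_apply complex_norm_square mult.commute del: of_real_power)
    have "cyl_expectation n f x
        = complex_of_real (LINT z|haar. (cmod (g (override_on z x {..<n})))\<^sup>2)" for x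
      unfolding cyl_expectation_apply f by (rule integral_complex_of_real)
    then show "cyl_expectation n f x \<in> \<real>" "0 \<le> Re (cyl_expectation n f x)" for x
      by simp_all
  qed
qed

text \<open>
  The left-hand side is a finite average of the values of \<open>cyl_expectation n f\<close>, and this is exactly
  the average of fibre integrals that computes the integral of \<open>f\<close>.
\<close>

lemma haar_trace_cyl_expectation: "haar_trace (cyl_expectation n f) = haar_trace f"
proof -
  have "cylindrical n (cyl_expectation n f)"
    using cyl_expectation_in_cylinder_alg by (simp add: cylinder_alg_def)
  from haar_integral_cylindrical[OF haar_probability_haar this]
  have "haar_trace (cyl_expectation n f)
      = (\<Sum>a\<in>prefix_group n. cyl_expectation n f a) /\<^sub>R card (prefix_group n)"
    by (simp add: haar_trace_def)
  also have "\<dots> = haar_trace f"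
    unfolding haar_trace_def cyl_expectation_apply
    by (rule haar_integral_average[OF haar_probability_haar, symmetric, where B = "norm f"])
      (auto simp: norm_bounded intro: borel_measurable_continuous_onI)
  finally show ?thesis .
qed

text \<open>
  On \<open>cylinder_alg n\<close> the trace of \<open>g\<^sup>* g\<close> is an average of the numbers \<open>\<bar>g a\<bar>\<^sup>2\<close> over the prefix group,
  and \<open>g\<close> is determined by its values there.
\<close>

lemma haar_trace_faithful:
  assumes g: "g \<in> cylinder_alg n" and 0: "haar_trace (mult_bcf (star_bcf g) g) = 0"
  shows "g = 0"
proof (rule bcontfun_eqI)
  fix x
  let ?G = "prefix_group n"
  have sq: "mult_bcf (star_bcf g) g z = complex_of_real ((cmod (g z))\<^sup>2)" for z
    by (simp add: bcf_apply complex_norm_square mult.commute del: of_real_power)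
  have "mult_bcf (star_bcf g) g \<in> cylinder_alg n"
    using g cstar_subalgebra_cylinder_alg by (simp add: cstar_subalgebra_def)
  then have "cylindrical n (mult_bcf (star_bcf g) g)"
    by (simp add: cylinder_alg_def)
  from haar_integral_cylindrical[OF haar_probability_haar this] 0
  have "complex_of_real (\<Sum>a\<in>?G. (cmod (g a))\<^sup>2) = 0"
    using card_prefix_group_pos[of n] by (simp add: haar_trace_def sq)
  then have "(\<Sum>a\<in>?G. (cmod (g a))\<^sup>2) = 0"
    using of_real_eq_0_iff by blast
  then have "\<forall>a\<in>?G. g a = 0"
    by (subst (asm) sum_nonneg_eq_0_iff) (auto simp: finite_prefix_group)
  moreover obtain a where "a \<in> ?G" "\<And>i. i < n \<Longrightarrow> a i = x i"
    by (rule ex_prefix[of n x]) blast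
  moreover have "cylindrical n g"
    using g by (simp add: cylinder_alg_def)
  ultimately show "g x = (0 :: cantor \<Rightarrow>\<^sub>C complex) x"
    using cylindricalD[of n g a x] by simp
qed

lemma haar_trace_diff: "haar_trace (f - g) = haar_trace f - haar_trace g"
  using haar_integrable[of "\<lambda>z. z"] by (simp add: haar_trace_def)

text \<open>
  The module property and invariance of the trace give \<open>\<tau> (b * E f) = \<tau> (E (b * f)) = \<tau> (b * f)\<close>
  for every \<open>b\<close> in the subalgebra, and the same for \<open>F\<close>. With \<open>b\<close> the adjoint of \<open>g = E f - F f\<close>
  this says that \<open>\<tau> (g\<^sup>* g) = 0\<close>.
\<close>

lemma cond_expectation_unique:
  assumes E: "cond_expectation (cylinder_alg n) E" "\<And>f. haar_trace (E f) = haar_trace f"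
    and F: "cond_expectation (cylinder_alg n) F" "\<And>f. haar_trace (F f) = haar_trace f"
  shows "E = F"
proof
  fix f
  let ?g = "E f - F f"
  have EF: "E f \<in> cylinder_alg n" "F f \<in> cylinder_alg n"
    using E(1) F(1) by (auto simp: cond_expectation_def)
  then have g: "?g \<in> cylinder_alg n"
    unfolding cylinder_alg_def mem_Collect_eq cylindrical_def minus_bcontfun.rep_eq by metis
  then have sg: "star_bcf ?g \<in> cylinder_alg n"
    using cstar_subalgebra_cylinder_alg by (simp add: cstar_subalgebra_def)
  have one: "unit_bcf \<in> cylinder_alg n"
    by (simp add: cylinder_alg_def cylindrical_def)
  have mult_unit: "mult_bcf h unit_bcf = h" for h :: "cantor \<Rightarrow>\<^sub>C complex"
    by (intro bcontfun_eqI) (simp add: bcf_apply)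
  have module: "H (mult_bcf b f) = mult_bcf b (H f)"
    if "cond_expectation (cylinder_alg n) H" "b \<in> cylinder_alg n" for H b
    using that one unfolding cond_expectation_def by (metis mult_unit)
  have "mult_bcf (star_bcf ?g) ?g = mult_bcf (star_bcf ?g) (E f) - mult_bcf (star_bcf ?g) (F f)"
    by (intro bcontfun_eqI) (simp add: bcf_apply algebra_simps)
  also have "haar_trace \<dots> = 0"
    unfolding haar_trace_diff module[OF E(1) sg, symmetric] module[OF F(1) sg, symmetric] E(2) F(2)
    by simp
  finally have "?g = 0"
    using haar_trace_faithful[OF g] by blast
  then show "E f = F f"
    by simp
qed

lemma the_cond_expectation_cantor_alg:
  "the_cond_expectation haar_trace (cantor_alg n) = cyl_expectation n"
  unfolding the_cond_expectation_def cantor_alg_eq_cylinder_alg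
  using cond_expectation_cyl_expectation haar_trace_cyl_expectation cond_expectation_unique
  by (intro the_equality) blast+

section \<open>The Monge-Kantorovich metric\<close>

lemma u_in_cylinder_alg: "n < k \<Longrightarrow> u n \<in> cylinder_alg k"
  by (simp add: cylinder_alg_def cylindrical_def u_apply)

text \<open>Flipping the coordinate \<open>n\<close> preserves the Haar measure and changes the sign of \<open>u n\<close>.\<close>

lemma haar_integral_u: "(LINT z|haar. u n z) = 0"
proof -
  define e where "e = (\<lambda>m. if m = n then 1 else 0 :: bit)"
  have sets: "sets haar = sets borel" and inv: "distr haar borel (\<lambda>z m. e m + z m) = haar"
    using haar_probability_haar by (simp_all add: haar_probability_def)
  have "(\<lambda>z m. e m + z m) \<in> measurable haar borel"
    using borel_measurable_translation
    by (simp add: measurable_cong_sets[OF sets refl])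
  then have "(LINT z|haar. u n z) = (LINT z|haar. u n (\<lambda>m. e m + z m))"
    using integral_distr[of "\<lambda>z m. e m + z m" haar borel "u n"] inv
    by (simp add: borel_measurable_continuous_onI)
  also have "\<dots> = (LINT z|haar. - u n z)"
  proof (intro arg_cong[of _ _ "lebesgue_integral haar"] ext)
    fix z
    show "u n (\<lambda>m. e m + z m) = - u n z"
      by (cases "z n") (simp_all add: u_apply e_def)
  qed
  finally show ?thesis
    by simp
qed

lemma cyl_expectation_u: "k \<le> n \<Longrightarrow> cyl_expectation k (u n) = 0"
proof (rule bcontfun_eqI)
  fix x
  assume "k \<le> n"
  then have "u n (override_on z x {..<k}) = u n z" for z
    by (simp add: u_apply)
  then show "cyl_expectation k (u n) x = (0 :: cantor \<Rightarrow>\<^sub>C complex) x"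
    by (simp add: cyl_expectation_apply haar_integral_u)
qed

lemma lip_seminorm_le_1_iff:
  assumes "\<And>n. 0 < \<beta> n"
  shows "lip_seminorm cantor_alg haar_trace \<beta> f \<le> 1 \<longleftrightarrow>
    (\<forall>n. norm (f - cyl_expectation n f) \<le> \<beta> n)"
  using assms by (simp add: lip_seminorm_def the_cond_expectation_cantor_alg SUP_le_iff divide_le_eq)

text \<open>
  The upper bound of the metric: \<open>cyl_expectation n f\<close> does not separate \<open>x\<close> from \<open>y\<close>, so only
  the two errors of approximation contribute to \<open>f x - f y\<close>.
\<close>

lemma dist_eval_le:
  assumes "norm (f - cyl_expectation n f) \<le> b" "\<And>i. i < n \<Longrightarrow> x i = y i"
  shows "cmod (f x - f y) \<le> 2 * b"
proof -
  let ?g = "f - cyl_expectation n f"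
  have "f x - f y = ?g x - ?g y"
    using cyl_expectation_cong[OF assms(2)] by simp
  then have "cmod (f x - f y) \<le> cmod (?g x) + cmod (?g y)"
    by (simp only: norm_triangle_ineq4)
  also have "\<dots> \<le> 2 * b"
    using norm_bounded[of ?g x] norm_bounded[of ?g y] assms(1) by linarith
  finally show ?thesis .
qed

text \<open>
  The lower bound of the metric: a function in the unit ball of the seminorm that separates points
  first differing at \<open>n\<close> by \<open>2 * \<beta> n\<close>. Monotonicity of \<open>\<beta>\<close> is used for the levels \<open>k \<le> n\<close>, where
  the error of approximation is the function itself.
\<close>

lemma lip_seminorm_scaled_u:
  assumes pos: "\<And>n. 0 < \<beta> n" and dec: "decseq \<beta>"
  shows "lip_seminorm cantor_alg haar_trace \<beta> (scaleC_bcf (complex_of_real (\<beta> n)) (u n)) \<le> 1"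
proof -
  let ?f = "scaleC_bcf (complex_of_real (\<beta> n)) (u n)"
  have E: "cyl_expectation k ?f = scaleC_bcf (complex_of_real (\<beta> n)) (cyl_expectation k (u n))" for k
    using cond_expectation_cyl_expectation by (simp add: cond_expectation_def)
  have "norm (?f - cyl_expectation k ?f) \<le> \<beta> k" for k
  proof (cases "k \<le> n")
    case True
    have "norm (?f - cyl_expectation k ?f) \<le> \<beta> n"
      unfolding E cyl_expectation_u[OF True]
      using pos[of n] by (intro norm_bound) (simp add: bcf_apply u_apply norm_mult)
    also have "\<dots> \<le> \<beta> k"
      using dec True by (rule decseqD)
    finally show ?thesis .
  next
    case False
    then have "cyl_expectation k (u n) = u n"
      by (intro cyl_expectation_id u_in_cylinder_alg) simp
    then show ?thesis
      using pos[of k] by (simp add: E less_imp_le)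
  qed
  then show ?thesis
    by (simp add: lip_seminorm_le_1_iff[OF pos])
qed

lemma mk_eq:
  fixes x y :: cantor
  assumes pos: "\<And>n. 0 < \<beta> n" and dec: "decseq \<beta>" and "x \<noteq> y"
  shows "mk (lip_seminorm cantor_alg haar_trace \<beta>) (point_eval x) (point_eval y) =
    ennreal (2 * \<beta> (LEAST n. x n \<noteq> y n))"
proof (rule antisym)
  define n where "n = (LEAST n. x n \<noteq> y n)"
  have "x n \<noteq> y n"
    unfolding n_def by (rule LeastI_ex) (use \<open>x \<noteq> y\<close> in auto)
  have agree: "x i = y i" if "i < n" for i
    using not_less_Least[of i "\<lambda>n. x n \<noteq> y n"] that unfolding n_def by blast
  let ?f = "scaleC_bcf (complex_of_real (\<beta> n)) (u n)"
  show "mk (lip_seminorm cantor_alg haar_trace \<beta>) (point_eval x) (point_eval y)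
      \<le> ennreal (2 * \<beta> (LEAST n. x n \<noteq> y n))"
    unfolding mk_def point_eval_def n_def[symmetric]
    by (intro SUP_least ennreal_leI dist_eval_le[OF _ agree])
      (auto simp: lip_seminorm_le_1_iff[OF pos])
  have "cmod (?f x - ?f y) = 2 * \<beta> n"
  proof (cases "x n = 1")
    case False
    then have "y n = 1"
      using \<open>x n \<noteq> y n\<close> by (cases "y n") auto
    then have "?f x - ?f y = complex_of_real (- (2 * \<beta> n))"
      using False by (simp add: bcf_apply u_apply)
    then show ?thesis
      unfolding \<open>?f x - ?f y = _\<close> norm_of_real using pos[of n] by simp
  next
    case True
    then have "y n = 0"
      using \<open>x n \<noteq> y n\<close> by (cases "y n") auto
    then have "?f x - ?f y = complex_of_real (2 * \<beta> n)"
      using True by (simp add: bcf_apply u_apply)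
    then show ?thesis
      unfolding \<open>?f x - ?f y = _\<close> norm_of_real using pos[of n] by simp
  qed
  moreover have "self_adjoint ?f"
    unfolding self_adjoint_def by (intro bcontfun_eqI) (simp add: bcf_apply u_apply)
  ultimately show "ennreal (2 * \<beta> (LEAST n. x n \<noteq> y n))
      \<le> mk (lip_seminorm cantor_alg haar_trace \<beta>) (point_eval x) (point_eval y)"
    unfolding mk_def point_eval_def n_def[symmetric]
    using lip_seminorm_scaled_u[OF pos dec] by (intro SUP_upper2[of ?f]) auto
qed

text \<open>
  If \<open>x\<close> and \<open>z\<close> differ at \<open>m\<close>, then \<open>y\<close> differs from one of them at \<open>m\<close>, so its first difference
  from that one is no later than \<open>m\<close>, and a smaller index gives a larger distance.
\<close>

lemma ultrametric_first_difference:
  fixes r :: "nat \<Rightarrow> real"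
  assumes pos: "\<And>n. 0 < r n" and dec: "decseq r"
  shows "ultrametric (UNIV :: (nat \<Rightarrow> 'a) set) (\<lambda>x y. if x = y then 0 else r (LEAST n. x n \<noteq> y n))"
    (is "ultrametric UNIV ?d")
proof -
  have nonneg: "0 \<le> ?d x y" for x y
    using pos less_imp_le by auto
  have ultra: "?d x z \<le> max (?d x y) (?d y z)" for x y z
  proof (cases "x = y \<or> y = z \<or> x = z")
    case True
    then show ?thesis
      using nonneg[of x y] by (auto simp: le_max_iff_disj)
  next
    case False
    define m where "m = (LEAST n. x n \<noteq> z n)"
    have "x m \<noteq> z m"
      unfolding m_def by (rule LeastI_ex) (use False in auto)
    then have "x m \<noteq> y m \<or> y m \<noteq> z m"
      by auto
    then have "(LEAST n. x n \<noteq> y n) \<le> m \<or> (LEAST n. y n \<noteq> z n) \<le> m"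
      by (auto intro: Least_le)
    then show ?thesis
      using False decseqD[OF dec] by (auto simp: m_def[symmetric] le_max_iff_disj)
  qed
  have "Metric_space UNIV ?d"
  proof
    fix x y z :: "nat \<Rightarrow> 'a"
    show "0 \<le> ?d x y"
      by (rule nonneg)
    show "?d x y = ?d y x"
      by (auto simp: eq_commute)
    show "?d x y = 0 \<longleftrightarrow> x = y"
      using pos by (auto simp: less_le)
    show "?d x z \<le> ?d x y + ?d y z"
      using ultra[where y = y] by (rule order_trans) (use nonneg[of x y] nonneg[of y z] in linarith)
  qed
  then show ?thesis
    using ultra by (simp add: ultrametric_def)
qed

theorem theorem7p5:
  fixes \<beta> :: "nat \<Rightarrow> real"
  assumes "\<And>n. 0 < \<beta> n"
    and "decseq \<beta>"
    and "\<beta> \<longlonglongrightarrow> 0"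
  shows "(\<forall>x y :: cantor.
      mk (lip_seminorm cantor_alg haar_trace \<beta>) (point_eval x) (point_eval y) =
        (if x = y then 0 else ennreal (2 * \<beta> (LEAST n. x n \<noteq> y n)))) \<and>
    ultrametric (UNIV :: cantor set)
      (\<lambda>x y. enn2real (mk (lip_seminorm cantor_alg haar_trace \<beta>) (point_eval x) (point_eval y)))"
proof -
  let ?mk = "\<lambda>x y. mk (lip_seminorm cantor_alg haar_trace \<beta>) (point_eval x) (point_eval y)"
  have refl: "?mk x x = 0" for x
  proof -
    have "?mk x x \<le> 0"
      unfolding mk_def by (rule SUP_least) simp
    then show ?thesis
      by simp
  qed
  have formula: "?mk x y = (if x = y then 0 else ennreal (2 * \<beta> (LEAST n. x n \<noteq> y n)))" for x y
    using refl mk_eq[OF assms(1,2)] by simp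
  then have "(\<lambda>x y. enn2real (?mk x y)) =
      (\<lambda>x y. if x = y then 0 else 2 * \<beta> (LEAST n. x n \<noteq> y n))"
    using assms(1) by (auto simp: fun_eq_iff less_imp_le)
  moreover have "ultrametric UNIV
      (\<lambda>x y :: cantor. if x = y then 0 else 2 * \<beta> (LEAST n. x n \<noteq> y n))"
    using assms(1,2) by (intro ultrametric_first_difference) (auto simp: decseq_def)
  ultimately show ?thesis
    using formula by simp
qed

end
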